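(* Let $\mathcal F$ be a fraction, possibly with replicates, of the complex coded full factorial design $\mathcal D$, with counting function $R=\sum_{\alpha\in L}b_\alpha X^\alpha$. Let $I$ be a non-empty subset of $\{1,\dots,m\}$ and $J=I^c$ its complement. (1) The number of replicates of the points of the fraction projected onto the $I$-factors is $$R_I(\zeta_I)=\#\mathcal D_J\sum_{\alpha_I\in L_I}b_{\alpha_I}X^{\alpha_I}(\zeta_I),\qquad \zeta_I\in\mathcal D_I.$$ (2) The fraction $\mathcal F$ factorially projects onto the $I$-factors if, and only if, $$R_I(\zeta_I)=\#\mathcal D_J\,b_0=\frac{\#\mathcal F}{\#\mathcal D_I}\quad\text{for all }\zeta_I\in\mathcal D_I.$$ This is equivalent to all the coefficients of the counting function involving only the $I$-factors being $0$: $b_{\alpha_I}=0$ for all $\alpha_I\in L_I$, $\alpha_I\neq(0,\dots,0)$. In such a case, the levels of a factor $X_i$, $i\in I$, appear equally often in $\mathcal F$. (3) If there exists a non-empty proper subset $J$ of $\{1,\dots,m\}$ such that the $J$-factors appear in all the non-null (non-constant) terms of the counting function, i.e. for every $\alpha\in L$ with $\alpha\neq(0,\dots,0)$ and $b_\alpha\neq0$ one has $\alpha_j\neq0$ for all $j\in J$, then $\mathcal F$ factorially projects onto the $I$-factors, with $I=J^c$. (4) For $1\le t\le m$, the fraction $\mathcal F$ is an orthogonal array of strength $t$ if, and only if, all the coefficients of the counting function up to the order $t$ are zero: $b_\alpha=0$ for all $\alpha\in L$ of order up to $t$, $\alpha\neq(0,\dots,0)$.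
   Context: Let $m\ge 1$ and let $n_1,\dots,n_m$ be positive integers. For a positive integer $n$, $\Omega_n\subset\mathbb C$ is the set of $n$-th roots of unity. The full factorial design is $\mathcal D=\Omega_{n_1}\times\cdots\times\Omega_{n_m}$ and the exponent set is $L=\mathbb Z_{n_1}\times\cdots\times\mathbb Z_{n_m}$, with elements $\alpha=(\alpha_1,\dots,\alpha_m)$, $0\le\alpha_j\le n_j-1$. For $\alpha\in L$, $X^\alpha:\mathcal D\to\mathbb C$ is $X^\alpha(\zeta_1,\dots,\zeta_m)=\zeta_1^{\alpha_1}\cdots\zeta_m^{\alpha_m}$, and $X_i(\zeta_1,\dots,\zeta_m)=\zeta_i$ is the $i$-th factor. The order of $\alpha$ is its number of non-zero entries. Every function $f:\mathcal D\to\mathbb C$ can be written uniquely as $\sum_{\alpha\in L}\theta_\alpha X^\alpha$ with $\theta_\alpha\in\mathbb C$. A fraction $\mathcal F$ is a multi-subset of $\mathcal D$ (points may be repeated). Its counting function $R$ gives, for each $\zeta\in\mathcal D$, the number of appearances of $\zeta$ in $\mathcal F$; $b_\alpha$ are its coefficients, and $\#\mathcal F=\sum_{\zeta\in\mathcal D}R(\zeta)$. For a non-empty $I\subset\{1,\dots,m\}$ with complement $J=I^c$, $\mathcal D_I=\prod_{i\in I}\Omega_{n_i}$ and $\mathcal D_J=\prod_{j\in J}\Omega_{n_j}$ are the full factorial designs over the $I$- and $J$-factors (with $\#\mathcal D_J=1$ if $J=\emptyset$), so $\mathcal D=\mathcal D_I\times\mathcal D_J$ and each $\zeta\in\mathcal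 D$ decomposes as $\zeta=(\zeta_I,\zeta_J)$. Let $L_I=\{\alpha\in L:\alpha_j=0\text{ for all }j\in J\}$; for $\alpha_I\in L_I$ the function $X^{\alpha_I}$ depends only on $\zeta_I$. $R_I(\zeta_I)$ is the number of points of $\mathcal F$ (counted with multiplicity) whose projection on the $I$-factors is $\zeta_I$. The fraction $\mathcal F$ factorially projects onto the $I$-factors if its projection (as a multiset) is the full factorial design $\mathcal D_I$ with each point appearing the same number $s$ of times, i.e. $R_I$ is constant. The fraction is a (mixed) orthogonal array of strength $t$ if it factorially projects onto the $I$-factors for every $I$ with $\#I=t$. *)

theory Defs
  imports "HOL-Analysis.Analysis" "HOL-Library.Multiset" "HOL-Library.FuncSet"
begin

text \<open>
  The factors are indexed by \<open>{1..m}\<close>, and \<open>n j\<close> is the number of levels of factor \<open>j\<close>.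
  Points and exponents are extensional functions on their index set.
\<close>

definition roots_of_unity :: "nat \<Rightarrow> complex set" where
  "roots_of_unity k = {z. z ^ k = 1}"

text \<open>The full design is \<open>full_design n {1..m}\<close>; the design over the \<open>I\<close>-factors is \<open>full_design n I\<close>.\<close>

definition full_design :: "(nat \<Rightarrow> nat) \<Rightarrow> nat set \<Rightarrow> (nat \<Rightarrow> complex) set" where
  "full_design n S = (\<Pi>\<^sub>E j\<in>S. roots_of_unity (n j))"

text \<open>Residue classes modulo \<open>n j\<close> are represented by \<open>0, \<dots>, n j - 1\<close>.\<close>

definition exponents :: "(nat \<Rightarrow> nat) \<Rightarrow> nat \<Rightarrow> (nat \<Rightarrow> nat) set" where
  "exponents n m = (\<Pi>\<^sub>E j\<in>{1..m}. {0..<n j})"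

definition exponents_on :: "(nat \<Rightarrow> nat) \<Rightarrow> nat \<Rightarrow> nat set \<Rightarrow> (nat \<Rightarrow> nat) set" where
  "exponents_on n m I = {\<alpha> \<in> exponents n m. \<forall>j\<in>{1..m} - I. \<alpha> j = 0}"

definition zero_exponent :: "nat \<Rightarrow> nat \<Rightarrow> nat" where
  "zero_exponent m = (\<lambda>j\<in>{1..m}. 0)"

definition exponent_order :: "nat \<Rightarrow> (nat \<Rightarrow> nat) \<Rightarrow> nat" where
  "exponent_order m \<alpha> = card {j\<in>{1..m}. \<alpha> j \<noteq> 0}"

text \<open>
  \<open>monomial {1..m} \<alpha>\<close> is the function \<open>X\<^sup>\<alpha>\<close> on the full design. For \<open>\<alpha> \<in> exponents_on n m I\<close> the
  factors outside \<open>I\<close> have exponent \<open>0\<close>, so \<open>monomial I \<alpha>\<close> is \<open>X\<^sup>\<alpha>\<close> viewed as a function of the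
  projection of the point onto the \<open>I\<close>-factors.
\<close>

definition monomial :: "nat set \<Rightarrow> (nat \<Rightarrow> nat) \<Rightarrow> (nat \<Rightarrow> complex) \<Rightarrow> complex" where
  "monomial S \<alpha> \<zeta> = (\<Prod>j\<in>S. \<zeta> j ^ \<alpha> j)"

definition is_fraction :: "(nat \<Rightarrow> nat) \<Rightarrow> nat \<Rightarrow> (nat \<Rightarrow> complex) multiset \<Rightarrow> bool" where
  "is_fraction n m F \<longleftrightarrow> set_mset F \<subseteq> full_design n {1..m}"

definition projection :: "nat set \<Rightarrow> (nat \<Rightarrow> complex) multiset \<Rightarrow> (nat \<Rightarrow> complex) multiset" where
  "projection I F = image_mset (\<lambda>\<zeta>. restrict \<zeta> I) F"

definition replicates :: "nat set \<Rightarrow> (nat \<Rightarrow> complex) multiset \<Rightarrow> (nat \<Rightarrow> complex) \<Rightarrow> nat" where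
  "replicates I F \<zeta> = count (projection I F) \<zeta>"

text \<open>The common multiplicity may be \<open>0\<close>, which happens exactly for the empty fraction.\<close>

definition factorially_projects ::
    "(nat \<Rightarrow> nat) \<Rightarrow> nat set \<Rightarrow> (nat \<Rightarrow> complex) multiset \<Rightarrow> bool" where
  "factorially_projects n I F \<longleftrightarrow> (\<exists>s. \<forall>\<zeta>\<in>full_design n I. replicates I F \<zeta> = s)"

definition orthogonal_array ::
    "(nat \<Rightarrow> nat) \<Rightarrow> nat \<Rightarrow> nat \<Rightarrow> (nat \<Rightarrow> complex) multiset \<Rightarrow> bool" where
  "orthogonal_array n m t F \<longleftrightarrow>
     (\<forall>I. I \<subseteq> {1..m} \<and> card I = t \<longrightarrow> factorially_projects n I F)"

definition levels_equally_often ::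
    "(nat \<Rightarrow> nat) \<Rightarrow> nat \<Rightarrow> (nat \<Rightarrow> complex) multiset \<Rightarrow> bool" where
  "levels_equally_often n i F \<longleftrightarrow>
     (\<exists>k. \<forall>\<omega>\<in>roots_of_unity (n i). size {#\<zeta> \<in># F. \<zeta> i = \<omega>#} = k)"

text \<open>\<open>b\<close> is the family of coefficients of the counting function of \<open>F\<close>.\<close>

definition counting_coefficients ::
    "(nat \<Rightarrow> nat) \<Rightarrow> nat \<Rightarrow> (nat \<Rightarrow> complex) multiset \<Rightarrow> ((nat \<Rightarrow> nat) \<Rightarrow> complex) \<Rightarrow> bool" where
  "counting_coefficients n m F b \<longleftrightarrow>
     (\<forall>\<zeta>\<in>full_design n {1..m}.
        of_nat (count F \<zeta>) = (\<Sum>\<alpha>\<in>exponents n m. b \<alpha> * monomial {1..m} \<alpha> \<zeta>))"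

end

theory Submission
  imports Defs
begin

text \<open>
  The monomials are the characters of the group \<open>\<Prod>\<^sub>j \<Omega>\<^bsub>n j\<^esub>\<close>, and everything follows from
  their orthogonality (\<open>monomial_orthogonality\<close>), which is proved one factor at a time.

  Counting the points of the fraction that project to \<open>\<zeta>\<^sub>I\<close> means summing the counting function
  over the fibre \<open>{\<zeta>\<^sub>I} \<times> D\<^sub>J\<close>. On that fibre \<open>X\<^sup>\<alpha>\<close> is a constant times a character of \<open>D\<^sub>J\<close>, whose
  sum is \<open>card D\<^sub>J\<close> if \<open>\<alpha>\<close> vanishes on \<open>J\<close> and \<open>0\<close> otherwise; this is the formula for \<open>R\<^sub>I\<close>
  (\<open>replicates_expansion\<close>). So \<open>R\<^sub>I\<close> has, up to the factor \<open>card D\<^sub>J\<close>, the coefficients \<open>b\<^sub>\<alpha>\<close> with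
  \<open>\<alpha>\<close> supported in \<open>I\<close>, and they are recovered as its inner products with characters of \<open>D\<^sub>I\<close>
  (\<open>coefficient_from_replicates\<close>). A function is constant exactly if it is orthogonal to every
  nontrivial character, which gives the coefficient criterion for factorial projection
  (\<open>factorially_projects_iff_coefficients\<close>).

  If \<open>R\<^sub>I\<close> is constant, only the constant term of its expansion is left, so its value is
  \<open>card D\<^sub>J * b\<^sub>0\<close>; summing over \<open>D\<^sub>I\<close> counts every point of the fraction once and gives the
  other form \<open>size F / card D\<^sub>I\<close> of this value.

  The remaining assertions follow from the criterion. It is inherited by subsets of \<open>I\<close>, in
  particular by single factors, which yields equally frequent levels. A hypothesis that every
  nonconstant term involves all of \<open>J\<close> leaves no nonconstant term supported off \<open>J\<close>. Finally, an
  exponent has order at most \<open>t\<close> exactly if its support lies in some set of \<open>t\<close> factors, which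
  turns the criterion for all such sets into the description of strength \<open>t\<close>.
\<close>

section \<open>Orthogonality of characters\<close>

lemma finite_roots_of_unity: "k \<ge> 1 \<Longrightarrow> finite (roots_of_unity k)"
  unfolding roots_of_unity_def by (rule finite_roots_unity)

lemma card_roots_of_unity: "k \<ge> 1 \<Longrightarrow> card (roots_of_unity k) = k"
  unfolding roots_of_unity_def by (rule card_roots_unity_eq) simp

lemma norm_roots_of_unity:
  assumes "k \<ge> 1" "z \<in> roots_of_unity k"
  shows "norm z = 1"
  using assms power_eq_1_iff[of z k] unfolding roots_of_unity_def by auto

lemma roots_of_unity_mult:
  "w \<in> roots_of_unity k \<Longrightarrow> z \<in> roots_of_unity k \<Longrightarrow> w * z \<in> roots_of_unity k"
  by (simp add: roots_of_unity_def power_mult_distrib)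

text \<open>There are \<open>k\<close> roots of unity, too many to be zeros of a polynomial of degree \<open>d < k\<close>.\<close>

lemma ex_root_of_unity_power_ne_1:
  assumes "0 < d" "d < k"
  obtains w where "w \<in> roots_of_unity k" "w ^ d \<noteq> 1"
proof -
  have "\<not> roots_of_unity k \<subseteq> roots_of_unity d"
    using assms card_mono[of "roots_of_unity d" "roots_of_unity k"]
    by (auto simp: card_roots_of_unity finite_roots_of_unity)
  then show ?thesis
    using that by (auto simp: roots_of_unity_def)
qed

lemma root_of_unity_separates_powers:
  assumes "a < k" "c < k" "a \<noteq> c"
  obtains w where "w \<in> roots_of_unity k" "w ^ a \<noteq> w ^ c"
proof -
  have *: "\<exists>w \<in> roots_of_unity k. w ^ p \<noteq> w ^ q" if "p < q" "q < k" for p q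
  proof -
    obtain w where w: "w \<in> roots_of_unity k" "w ^ (q - p) \<noteq> 1"
      using \<open>p < q\<close> \<open>q < k\<close> by (auto intro: ex_root_of_unity_power_ne_1[of "q - p" k])
    have "w ^ q = w ^ p * w ^ (q - p)"
      using \<open>p < q\<close> by (simp flip: power_add)
    moreover have "w \<noteq> 0"
      using norm_roots_of_unity[of k w] w \<open>q < k\<close> by auto
    ultimately have "w ^ p \<noteq> w ^ q"
      using w by auto
    with w show ?thesis by blast
  qed
  from assms consider "a < c" | "c < a" by linarith
  then show ?thesis
    using *[of a c] *[of c a] assms that by cases metis+
qed

text \<open>
  Multiplication by a root of unity \<open>w\<close> permutes the summation range and scales the sum by
  \<open>w ^ a * cnj w ^ c\<close>; for distinct exponents some \<open>w\<close> makes this factor different from \<open>1\<close>.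
\<close>

lemma roots_of_unity_orthogonality:
  assumes "a < k" "c < k"
  shows "(\<Sum>z\<in>roots_of_unity k. z ^ a * cnj (z ^ c)) = (if a = c then of_nat k else 0)"
proof (cases "a = c")
  case True
  have "z ^ a * cnj (z ^ c) = 1" if "z \<in> roots_of_unity k" for z
    using norm_roots_of_unity[of k z] that assms True
    by (simp add: norm_power complex_norm_square[symmetric] del: complex_cnj_power)
  then show ?thesis
    using True assms card_roots_of_unity[of k] by simp
next
  case False
  then obtain w where w: "w \<in> roots_of_unity k" "w ^ a \<noteq> w ^ c"
    using root_of_unity_separates_powers assms by metis
  have nw: "norm w = 1"
    using norm_roots_of_unity[of k w] w assms by auto
  have inj: "inj_on ((*) w) (roots_of_unity k)"
    using nw by (auto simp: inj_on_def)
  have "(*) w ` roots_of_unity k = roots_of_unity k"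
    using assms inj w
    by (intro endo_inj_surj) (auto simp: finite_roots_of_unity roots_of_unity_mult)
  then have bij: "bij_betw ((*) w) (roots_of_unity k) (roots_of_unity k)"
    using inj by (simp add: bij_betw_def)
  let ?S = "\<Sum>z\<in>roots_of_unity k. z ^ a * cnj (z ^ c)"
  have "?S = (\<Sum>z\<in>roots_of_unity k. (w * z) ^ a * cnj ((w * z) ^ c))"
    by (rule sum.reindex_bij_betw[OF bij, symmetric])
  also have "\<dots> = (w ^ a * cnj (w ^ c)) * ?S"
    by (simp add: power_mult_distrib sum_distrib_left mult_ac)
  finally have S: "?S = (w ^ a * cnj (w ^ c)) * ?S" .
  have unit: "cnj (w ^ c) * w ^ c = 1"
    using nw complex_norm_square[of "w ^ c"] by (simp add: norm_power mult.commute)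
  have "w ^ a * cnj (w ^ c) \<noteq> 1"
  proof
    assume "w ^ a * cnj (w ^ c) = 1"
    then have "w ^ a * (cnj (w ^ c) * w ^ c) = w ^ c"
      by (metis mult.assoc mult_1)
    with unit w show False by simp
  qed
  with S False show ?thesis by auto
qed

lemma card_full_design:
  assumes "finite S" "\<And>j. j \<in> S \<Longrightarrow> n j \<ge> 1"
  shows "card (full_design n S) = (\<Prod>j\<in>S. n j)"
  unfolding full_design_def
  using assms by (simp add: card_PiE card_roots_of_unity)

lemma finite_full_design:
  assumes "finite S" "\<And>j. j \<in> S \<Longrightarrow> n j \<ge> 1"
  shows "finite (full_design n S)"
  unfolding full_design_def using assms by (auto intro!: finite_PiE finite_roots_of_unity)

lemma card_full_design_pos:
  assumes "finite S" "\<And>j. j \<in> S \<Longrightarrow> n j \<ge> 1"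
  shows "card (full_design n S) > 0"
  using assms by (auto simp: card_full_design Suc_le_eq)

lemma monomial_orthogonality:
  assumes fin: "finite S"
    and "\<And>j. j \<in> S \<Longrightarrow> \<alpha> j < n j" "\<And>j. j \<in> S \<Longrightarrow> \<beta> j < n j"
  shows "(\<Sum>\<zeta>\<in>full_design n S. monomial S \<alpha> \<zeta> * cnj (monomial S \<beta> \<zeta>)) =
           (if \<forall>j\<in>S. \<alpha> j = \<beta> j then of_nat (card (full_design n S)) else 0)"
proof -
  have pos: "n j \<ge> 1" if "j \<in> S" for j
    using assms(2)[OF that] by simp
  have "(\<Sum>\<zeta>\<in>full_design n S. monomial S \<alpha> \<zeta> * cnj (monomial S \<beta> \<zeta>)) =
      (\<Sum>\<zeta>\<in>full_design n S. \<Prod>j\<in>S. \<zeta> j ^ \<alpha> j * cnj (\<zeta> j ^ \<beta> j))"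
    by (simp add: monomial_def prod.distrib)
  also have "\<dots> = (\<Prod>j\<in>S. \<Sum>z\<in>roots_of_unity (n j). z ^ \<alpha> j * cnj (z ^ \<beta> j))"
    unfolding full_design_def using fin pos
    by (subst prod_sum_PiE) (auto simp: finite_roots_of_unity)
  also have "\<dots> = (\<Prod>j\<in>S. if \<alpha> j = \<beta> j then of_nat (n j) else 0)"
    using assms by (intro prod.cong refl roots_of_unity_orthogonality) auto
  also have "\<dots> = (if \<forall>j\<in>S. \<alpha> j = \<beta> j then of_nat (card (full_design n S)) else 0)"
    using fin pos by (auto simp: card_full_design)
  finally show ?thesis .
qed

lemma sum_monomial_full_design:
  assumes "finite S" "\<And>j. j \<in> S \<Longrightarrow> \<alpha> j < n j"
  shows "(\<Sum>\<zeta>\<in>full_design n S. monomial S \<alpha> \<zeta>) =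
           (if \<forall>j\<in>S. \<alpha> j = 0 then of_nat (card (full_design n S)) else 0)"
proof -
  have "0 < n j" if "j \<in> S" for j
    using assms(2)[OF that] by simp
  then show ?thesis
    using monomial_orthogonality[of S \<alpha> n "\<lambda>_. 0"] assms by (simp add: monomial_def)
qed

section \<open>Exponents\<close>

lemma finite_exponents: "finite (exponents n m)"
  unfolding exponents_def by (auto intro: finite_PiE)

lemma exponents_less: "\<alpha> \<in> exponents n m \<Longrightarrow> j \<in> {1..m} \<Longrightarrow> \<alpha> j < n j"
  unfolding exponents_def by (auto dest: PiE_mem)

lemma exponents_on_subset: "exponents_on n m I \<subseteq> exponents n m"
  unfolding exponents_on_def by auto

lemma exponents_on_less:
  assumes "\<alpha> \<in> exponents_on n m I" "I \<subseteq> {1..m}" "j \<in> I"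
  shows "\<alpha> j < n j"
  using assms by (intro exponents_less[of \<alpha> n m]) (auto simp: exponents_on_def)

lemma exponents_on_mono: "I \<subseteq> I' \<Longrightarrow> exponents_on n m I \<subseteq> exponents_on n m I'"
  unfolding exponents_on_def by auto

lemma zero_exponent_in_exponents_on:
  assumes "\<And>j. j \<in> {1..m} \<Longrightarrow> n j \<ge> 1"
  shows "zero_exponent m \<in> exponents_on n m I"
  using assms by (auto simp: exponents_on_def exponents_def zero_exponent_def Suc_le_eq)

lemma exponents_on_eqI:
  assumes "\<alpha> \<in> exponents_on n m I" "\<beta> \<in> exponents_on n m I" "\<And>j. j \<in> I \<Longrightarrow> \<alpha> j = \<beta> j"
  shows "\<alpha> = \<beta>"
proof (rule PiE_ext[of _ "{1..m}" "\<lambda>j. {0..<n j}"])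
  show "\<alpha> j = \<beta> j" if "j \<in> {1..m}" for j
    using assms that by (cases "j \<in> I") (auto simp: exponents_on_def)
qed (use assms in \<open>auto simp: exponents_on_def exponents_def\<close>)

lemma monomial_zero_exponent: "I \<subseteq> {1..m} \<Longrightarrow> monomial I (zero_exponent m) \<zeta> = 1"
  unfolding monomial_def zero_exponent_def by (intro prod.neutral) auto

section \<open>Replicates of a projected fraction\<close>

lemma replicates_eq_size_filter:
  "replicates I F \<zeta> = size {#x \<in># F. restrict x I = \<zeta>#}"
  unfolding replicates_def projection_def by (induction F) auto

lemma restrict_full_design:
  "\<zeta> \<in> full_design n S \<Longrightarrow> I \<subseteq> S \<Longrightarrow> restrict \<zeta> I \<in> full_design n I"
  unfolding full_design_def by auto

lemma sum_replicates:
  assumes "is_fraction n m F" "I \<subseteq> {1..m}" "\<And>j. j \<in> {1..m} \<Longrightarrow> n j \<ge> 1"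
  shows "(\<Sum>\<zeta>\<in>full_design n I. replicates I F \<zeta>) = size F"
proof -
  have fin: "finite (full_design n I)"
    using assms by (intro finite_full_design) (auto intro: finite_subset)
  have sub: "set_mset (projection I F) \<subseteq> full_design n I"
    using assms restrict_full_design[of _ n "{1..m}" I]
    by (auto simp: is_fraction_def projection_def)
  have "size F = size (projection I F)"
    by (simp add: projection_def)
  also have "\<dots> = (\<Sum>\<zeta>\<in>full_design n I. count (projection I F) \<zeta>)"
    unfolding size_multiset_overloaded_eq
    using fin sub by (intro sum.mono_neutral_left) (auto simp: not_in_iff)
  finally show ?thesis
    by (simp add: replicates_def)
qed

text \<open>The points \<open>(\<zeta>\<^sub>I, y)\<close> with \<open>y \<in> D\<^sub>J\<close> are exactly those with projection \<open>\<zeta>\<^sub>I\<close>.\<close>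

lemma replicates_eq_sum_fibre:
  assumes "is_fraction n m F" "I \<subseteq> {1..m}" "\<And>j. j \<in> {1..m} \<Longrightarrow> n j \<ge> 1"
    and \<zeta>: "\<zeta> \<in> full_design n I"
  shows "replicates I F \<zeta> =
    (\<Sum>y\<in>full_design n ({1..m} - I). count F (\<lambda>j. if j \<in> I then \<zeta> j else y j))"
proof -
  let ?J = "{1..m} - I"
  define glue where "glue = (\<lambda>y j. if j \<in> I then \<zeta> j else (y j :: complex))"
  have fin: "finite (full_design n {1..m})"
    using assms by (intro finite_full_design) auto
  have bij: "bij_betw glue (full_design n ?J) {x \<in> full_design n {1..m}. restrict x I = \<zeta>}"
  proof (rule bij_betwI[where g = "\<lambda>x. restrict x ?J"])
    show "glue \<in> full_design n ?J \<rightarrow> {x \<in> full_design n {1..m}. restrict x I = \<zeta>}"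
      using \<zeta> \<open>I \<subseteq> {1..m}\<close>
      by (auto simp: full_design_def glue_def PiE_iff extensional_def restrict_def fun_eq_iff)
    show "(\<lambda>x. restrict x ?J) \<in> {x \<in> full_design n {1..m}. restrict x I = \<zeta>} \<rightarrow> full_design n ?J"
      by (auto simp: restrict_full_design)
    show "restrict (glue y) ?J = y" if "y \<in> full_design n ?J" for y
      using that by (auto simp: full_design_def glue_def PiE_iff extensional_def fun_eq_iff)
    show "glue (restrict x ?J) = x" if "x \<in> {x \<in> full_design n {1..m}. restrict x I = \<zeta>}" for x
    proof -
      from that have x: "x \<in> full_design n {1..m}" "\<zeta> = restrict x I" by auto
      then show ?thesis
        by (auto simp: full_design_def glue_def PiE_iff extensional_def fun_eq_iff)
    qed
  qed
  have "replicates I F \<zeta> = (\<Sum>x \<in> set_mset {#x \<in># F. restrict x I = \<zeta>#}. count F x)"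
    unfolding replicates_eq_size_filter size_multiset_overloaded_eq by (intro sum.cong) auto
  also have "\<dots> = (\<Sum>x | x \<in> full_design n {1..m} \<and> restrict x I = \<zeta>. count F x)"
    using fin assms(1)
    by (intro sum.mono_neutral_left) (auto simp: is_fraction_def not_in_iff)
  also have "\<dots> = (\<Sum>y\<in>full_design n ?J. count F (glue y))"
    using sum.reindex_bij_betw[OF bij, of "count F"] by simp
  finally show ?thesis
    by (simp add: glue_def)
qed

text \<open>
  Along the fibre over \<open>\<zeta>\<close>, the terms that involve a factor outside \<open>I\<close> sum to \<open>0\<close>, and every
  other term is constant and contributes its value once for each point of the fibre.
\<close>

theorem replicates_expansion:
  assumes "is_fraction n m F" "counting_coefficients n m F b" "I \<subseteq> {1..m}"
    and pos: "\<And>j. j \<in> {1..m} \<Longrightarrow> n j \<ge> 1"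
    and \<zeta>: "\<zeta> \<in> full_design n I"
  shows "of_nat (replicates I F \<zeta>) =
    of_nat (card (full_design n ({1..m} - I))) *
    (\<Sum>\<alpha>\<in>exponents_on n m I. b \<alpha> * monomial I \<alpha> \<zeta>)"
proof -
  let ?J = "{1..m} - I"
  let ?glue = "\<lambda>y j. if j \<in> I then \<zeta> j else (y j :: complex)"
  let ?c = "of_nat (card (full_design n ?J)) :: complex"
  have glue: "?glue y \<in> full_design n {1..m}" if "y \<in> full_design n ?J" for y
    using that \<zeta> \<open>I \<subseteq> {1..m}\<close>
    by (auto simp: full_design_def PiE_iff extensional_def)
  have mono: "monomial {1..m} \<alpha> (?glue y) = monomial I \<alpha> \<zeta> * monomial ?J \<alpha> y" for \<alpha> y
  proof -
    have "monomial {1..m} \<alpha> (?glue y) =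
        (\<Prod>j\<in>?J. ?glue y j ^ \<alpha> j) * (\<Prod>j\<in>I. ?glue y j ^ \<alpha> j)"
      unfolding monomial_def using \<open>I \<subseteq> {1..m}\<close> by (intro prod.subset_diff) auto
    then show ?thesis
      by (simp add: monomial_def)
  qed
  have "of_nat (replicates I F \<zeta>) =
      (\<Sum>y\<in>full_design n ?J. \<Sum>\<alpha>\<in>exponents n m. b \<alpha> * monomial {1..m} \<alpha> (?glue y))"
  proof -
    have "replicates I F \<zeta> = (\<Sum>y\<in>full_design n ?J. count F (?glue y))"
      by (rule replicates_eq_sum_fibre[OF assms(1,3) pos \<zeta>])
    moreover have "of_nat (count F (?glue y)) =
        (\<Sum>\<alpha>\<in>exponents n m. b \<alpha> * monomial {1..m} \<alpha> (?glue y))"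
      if "y \<in> full_design n ?J" for y
      using assms(2) glue[OF that] unfolding counting_coefficients_def by blast
    ultimately show ?thesis
      by simp
  qed
  also have "\<dots> = (\<Sum>\<alpha>\<in>exponents n m. \<Sum>y\<in>full_design n ?J. b \<alpha> * monomial {1..m} \<alpha> (?glue y))"
    by (rule sum.swap)
  also have "\<dots> = (\<Sum>\<alpha>\<in>exponents n m. b \<alpha> * monomial I \<alpha> \<zeta> * (\<Sum>y\<in>full_design n ?J. monomial ?J \<alpha> y))"
    unfolding mono by (simp add: sum_distrib_left mult_ac)
  also have "\<dots> = (\<Sum>\<alpha>\<in>exponents n m. if \<forall>j\<in>?J. \<alpha> j = 0 then ?c * (b \<alpha> * monomial I \<alpha> \<zeta>) else 0)"
    by (intro sum.cong refl, subst sum_monomial_full_design) (auto intro: exponents_less)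
  also have "\<dots> = (\<Sum>\<alpha>\<in>exponents_on n m I. ?c * (b \<alpha> * monomial I \<alpha> \<zeta>))"
    unfolding exponents_on_def by (rule sum.inter_filter[symmetric, OF finite_exponents])
  finally show ?thesis
    by (simp add: sum_distrib_left)
qed

section \<open>Factorial projection in terms of the coefficients\<close>

text \<open>
  Fourier inversion: in the inner product of the expansion of \<open>R\<^sub>I\<close> with a character, orthogonality
  kills every term but one. Since both cardinalities are positive, \<open>R\<^sub>I\<close> determines \<open>b \<beta>\<close>.
\<close>

lemma coefficient_from_replicates:
  assumes "is_fraction n m F" "counting_coefficients n m F b" "I \<subseteq> {1..m}"
    and pos: "\<And>j. j \<in> {1..m} \<Longrightarrow> n j \<ge> 1"
    and \<beta>: "\<beta> \<in> exponents_on n m I"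
  shows "(\<Sum>\<zeta>\<in>full_design n I. of_nat (replicates I F \<zeta>) * cnj (monomial I \<beta> \<zeta>)) =
    of_nat (card (full_design n ({1..m} - I))) * of_nat (card (full_design n I)) * b \<beta>"
proof -
  let ?c = "of_nat (card (full_design n ({1..m} - I))) :: complex"
  let ?d = "of_nat (card (full_design n I)) :: complex"
  have less: "\<alpha> j < n j" if "\<alpha> \<in> exponents_on n m I" "j \<in> I" for \<alpha> j
    using exponents_on_less \<open>I \<subseteq> {1..m}\<close> that by blast
  have fin: "finite I"
    using \<open>I \<subseteq> {1..m}\<close> finite_subset by blast
  have orth: "(\<Sum>\<zeta>\<in>full_design n I. monomial I \<alpha> \<zeta> * cnj (monomial I \<beta> \<zeta>)) =
      (if \<alpha> = \<beta> then ?d else 0)" if "\<alpha> \<in> exponents_on n m I" for \<alpha>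
    using monomial_orthogonality[of I \<alpha> n \<beta>] fin less that \<beta> exponents_on_eqI[OF that \<beta>]
    by (auto split: if_splits)
  have "(\<Sum>\<zeta>\<in>full_design n I. of_nat (replicates I F \<zeta>) * cnj (monomial I \<beta> \<zeta>)) =
      (\<Sum>\<zeta>\<in>full_design n I. \<Sum>\<alpha>\<in>exponents_on n m I.
         ?c * b \<alpha> * (monomial I \<alpha> \<zeta> * cnj (monomial I \<beta> \<zeta>)))"
  proof (rule sum.cong[OF refl])
    fix \<zeta> assume "\<zeta> \<in> full_design n I"
    then have "of_nat (replicates I F \<zeta>) = ?c * (\<Sum>\<alpha>\<in>exponents_on n m I. b \<alpha> * monomial I \<alpha> \<zeta>)"
      by (intro replicates_expansion[OF assms(1-3) pos])
    then show "of_nat (replicates I F \<zeta>) * cnj (monomial I \<beta> \<zeta>) =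
        (\<Sum>\<alpha>\<in>exponents_on n m I. ?c * b \<alpha> * (monomial I \<alpha> \<zeta> * cnj (monomial I \<beta> \<zeta>)))"
      by (simp add: sum_distrib_left sum_distrib_right mult_ac)
  qed
  also have "\<dots> = (\<Sum>\<alpha>\<in>exponents_on n m I. ?c * b \<alpha> *
      (\<Sum>\<zeta>\<in>full_design n I. monomial I \<alpha> \<zeta> * cnj (monomial I \<beta> \<zeta>)))"
    by (subst sum.swap) (simp add: sum_distrib_left)
  also have "\<dots> = (\<Sum>\<alpha>\<in>exponents_on n m I. if \<alpha> = \<beta> then ?c * b \<alpha> * ?d else 0)"
    by (intro sum.cong refl) (simp add: orth)
  also have "\<dots> = ?c * ?d * b \<beta>"
    using \<beta> finite_subset[OF exponents_on_subset finite_exponents, of n m I]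
    by (simp add: mult_ac)
  finally show ?thesis .
qed

lemma replicates_if_coefficients_vanish:
  assumes "is_fraction n m F" "counting_coefficients n m F b" "I \<subseteq> {1..m}"
    and pos: "\<And>j. j \<in> {1..m} \<Longrightarrow> n j \<ge> 1"
    and van: "\<forall>\<alpha>\<in>exponents_on n m I. \<alpha> \<noteq> zero_exponent m \<longrightarrow> b \<alpha> = 0"
    and \<zeta>: "\<zeta> \<in> full_design n I"
  shows "of_nat (replicates I F \<zeta>) =
    of_nat (card (full_design n ({1..m} - I))) * b (zero_exponent m)"
proof -
  have "(\<Sum>\<alpha>\<in>exponents_on n m I. b \<alpha> * monomial I \<alpha> \<zeta>) =
      (\<Sum>\<alpha>\<in>{zero_exponent m}. b \<alpha> * monomial I \<alpha> \<zeta>)"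
    using van zero_exponent_in_exponents_on[of m n I, OF pos]
    by (intro sum.mono_neutral_right finite_subset[OF exponents_on_subset finite_exponents]) auto
  then show ?thesis
    using replicates_expansion[OF assms(1-4) \<zeta>] monomial_zero_exponent[OF \<open>I \<subseteq> {1..m}\<close>] by simp
qed

lemma factorially_projectsI:
  assumes "\<And>\<zeta>. \<zeta> \<in> full_design n I \<Longrightarrow> of_nat (replicates I F \<zeta>) = (c :: complex)"
  shows "factorially_projects n I F"
proof -
  have "replicates I F \<zeta> = replicates I F \<xi>"
    if "\<zeta> \<in> full_design n I" "\<xi> \<in> full_design n I" for \<zeta> \<xi>
    using assms that by (metis of_nat_eq_iff)
  then show ?thesis
    unfolding factorially_projects_def by metis
qed

text \<open>
  Vanishing coefficients leave only the constant term. Conversely, the inner product of a constant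
  \<open>R\<^sub>I\<close> with a nontrivial character is a multiple of the sum of that character, hence \<open>0\<close>, so by
  inversion the coefficient is \<open>0\<close>.
\<close>

theorem factorially_projects_iff_coefficients:
  assumes "is_fraction n m F" "counting_coefficients n m F b" "I \<subseteq> {1..m}"
    and pos: "\<And>j. j \<in> {1..m} \<Longrightarrow> n j \<ge> 1"
  shows "factorially_projects n I F \<longleftrightarrow>
    (\<forall>\<alpha>\<in>exponents_on n m I. \<alpha> \<noteq> zero_exponent m \<longrightarrow> b \<alpha> = 0)"
proof
  assume "\<forall>\<alpha>\<in>exponents_on n m I. \<alpha> \<noteq> zero_exponent m \<longrightarrow> b \<alpha> = 0"
  then show "factorially_projects n I F"
    using replicates_if_coefficients_vanish[OF assms] by (intro factorially_projectsI) auto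
next
  assume "factorially_projects n I F"
  then obtain s where s: "\<And>\<zeta>. \<zeta> \<in> full_design n I \<Longrightarrow> replicates I F \<zeta> = s"
    unfolding factorially_projects_def by blast
  have fin: "finite I"
    using \<open>I \<subseteq> {1..m}\<close> finite_subset by blast
  show "\<forall>\<alpha>\<in>exponents_on n m I. \<alpha> \<noteq> zero_exponent m \<longrightarrow> b \<alpha> = 0"
  proof (intro ballI impI)
    fix \<alpha> assume \<alpha>: "\<alpha> \<in> exponents_on n m I" "\<alpha> \<noteq> zero_exponent m"
    have "zero_exponent m j = 0" if "j \<in> I" for j
      using that \<open>I \<subseteq> {1..m}\<close> by (auto simp: zero_exponent_def)
    then have nz: "\<not> (\<forall>j\<in>I. \<alpha> j = 0)"
      using \<alpha> exponents_on_eqI[OF \<alpha>(1) zero_exponent_in_exponents_on[of m n I, OF pos]] by metis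
    have "(\<Sum>\<zeta>\<in>full_design n I. cnj (monomial I \<alpha> \<zeta>)) = 0"
    proof -
      have "(\<Sum>\<zeta>\<in>full_design n I. monomial I \<alpha> \<zeta>) =
          (if \<forall>j\<in>I. \<alpha> j = 0 then of_nat (card (full_design n I)) else 0)"
        using fin exponents_on_less[OF \<alpha>(1) \<open>I \<subseteq> {1..m}\<close>] by (rule sum_monomial_full_design)
      then have "(\<Sum>\<zeta>\<in>full_design n I. monomial I \<alpha> \<zeta>) = 0"
        unfolding if_not_P[OF nz] .
      then show ?thesis
        by (simp flip: cnj_sum)
    qed
    then have "(\<Sum>\<zeta>\<in>full_design n I. of_nat (replicates I F \<zeta>) * cnj (monomial I \<alpha> \<zeta>)) = 0"
      using s by (simp flip: sum_distrib_left)
    moreover have "card (full_design n ({1..m} - I)) > 0" "card (full_design n I) > 0"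
      using \<open>I \<subseteq> {1..m}\<close> fin pos by (auto intro!: card_full_design_pos)
    ultimately show "b \<alpha> = 0"
      using coefficient_from_replicates[OF assms \<alpha>(1)] by auto
  qed
qed

lemma factorially_projects_iff_replicates:
  assumes "is_fraction n m F" "counting_coefficients n m F b" "I \<subseteq> {1..m}"
    and pos: "\<And>j. j \<in> {1..m} \<Longrightarrow> n j \<ge> 1"
  shows "factorially_projects n I F \<longleftrightarrow>
    (\<forall>\<zeta>\<in>full_design n I.
       of_nat (replicates I F \<zeta>) =
         of_nat (card (full_design n ({1..m} - I))) * b (zero_exponent m) \<and>
       of_nat (card (full_design n ({1..m} - I))) * b (zero_exponent m) =
         of_nat (size F) / of_nat (card (full_design n I)))"
    (is "_ \<longleftrightarrow> (\<forall>\<zeta>\<in>_. _ = ?r \<and> _)")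
proof
  assume "factorially_projects n I F"
  then have r: "of_nat (replicates I F \<zeta>) = ?r" if "\<zeta> \<in> full_design n I" for \<zeta>
    using replicates_if_coefficients_vanish[OF assms] factorially_projects_iff_coefficients[OF assms]
      that by blast
  have "of_nat (size F) = (\<Sum>\<zeta>\<in>full_design n I. of_nat (replicates I F \<zeta>) :: complex)"
    using sum_replicates[OF assms(1,3) pos] by (simp flip: of_nat_sum)
  also have "\<dots> = of_nat (card (full_design n I)) * ?r"
    by (simp add: r)
  finally have "of_nat (size F) = of_nat (card (full_design n I)) * ?r" .
  moreover have "card (full_design n I) > 0"
    using \<open>I \<subseteq> {1..m}\<close> pos by (intro card_full_design_pos) (auto intro: finite_subset)
  ultimately have "?r = of_nat (size F) / of_nat (card (full_design n I))"
    by (simp add: field_simps)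
  with r show "\<forall>\<zeta>\<in>full_design n I. of_nat (replicates I F \<zeta>) = ?r \<and>
      ?r = of_nat (size F) / of_nat (card (full_design n I))"
    by blast
qed (auto intro: factorially_projectsI)

lemma levels_equally_often_if_factorially_projects:
  assumes "factorially_projects n {i} F"
  shows "levels_equally_often n i F"
proof -
  obtain s where s: "\<And>\<zeta>. \<zeta> \<in> full_design n {i} \<Longrightarrow> replicates {i} F \<zeta> = s"
    using assms unfolding factorially_projects_def by blast
  have "size {#\<zeta> \<in># F. \<zeta> i = \<omega>#} = s" if "\<omega> \<in> roots_of_unity (n i)" for \<omega>
  proof -
    have "(\<lambda>_\<in>{i}. \<omega>) \<in> full_design n {i}"
      using that by (auto simp: full_design_def)
    moreover have "restrict x {i} = (\<lambda>_\<in>{i}. \<omega>) \<longleftrightarrow> x i = \<omega>" for x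
      by (auto simp: restrict_def fun_eq_iff)
    ultimately show ?thesis
      using s[of "\<lambda>_\<in>{i}. \<omega>"] by (simp add: replicates_eq_size_filter)
  qed
  then show ?thesis
    unfolding levels_equally_often_def by blast
qed

text \<open>
  An exponent of order at most \<open>t\<close> belongs to \<open>exponents_on n m I\<close> for some \<open>I\<close> with \<open>t\<close> elements,
  since its support can be enlarged to such a set within the \<open>m \<ge> t\<close> factors.
\<close>

theorem orthogonal_array_iff_coefficients:
  assumes "is_fraction n m F" "counting_coefficients n m F b"
    and pos: "\<And>j. j \<in> {1..m} \<Longrightarrow> n j \<ge> 1"
    and "t \<le> m"
  shows "orthogonal_array n m t F \<longleftrightarrow>
    (\<forall>\<alpha>\<in>exponents n m. exponent_order m \<alpha> \<le> t \<and> \<alpha> \<noteq> zero_exponent m \<longrightarrow> b \<alpha> = 0)"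
proof
  assume oa: "orthogonal_array n m t F"
  show "\<forall>\<alpha>\<in>exponents n m. exponent_order m \<alpha> \<le> t \<and> \<alpha> \<noteq> zero_exponent m \<longrightarrow> b \<alpha> = 0"
  proof (intro ballI impI, elim conjE)
    fix \<alpha> assume \<alpha>: "\<alpha> \<in> exponents n m" "exponent_order m \<alpha> \<le> t" "\<alpha> \<noteq> zero_exponent m"
    have "\<exists>I. {j\<in>{1..m}. \<alpha> j \<noteq> 0} \<subseteq> I \<and> I \<subseteq> {1..m} \<and> card I = t"
      using \<alpha>(2) \<open>t \<le> m\<close> by (intro exists_subset_between) (auto simp: exponent_order_def)
    then obtain I where I: "{j\<in>{1..m}. \<alpha> j \<noteq> 0} \<subseteq> I" "I \<subseteq> {1..m}" "card I = t"
      by blast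
    then have "factorially_projects n I F"
      using oa by (auto simp: orthogonal_array_def)
    moreover have "\<alpha> \<in> exponents_on n m I"
      using I \<alpha> by (auto simp: exponents_on_def)
    ultimately show "b \<alpha> = 0"
      using factorially_projects_iff_coefficients[OF assms(1,2) I(2) pos] \<alpha> by blast
  qed
next
  assume van: "\<forall>\<alpha>\<in>exponents n m. exponent_order m \<alpha> \<le> t \<and> \<alpha> \<noteq> zero_exponent m \<longrightarrow> b \<alpha> = 0"
  show "orthogonal_array n m t F"
    unfolding orthogonal_array_def
  proof (intro allI impI, elim conjE)
    fix I assume I: "I \<subseteq> {1..m}" "card I = t"
    have "exponent_order m \<alpha> \<le> t" if "\<alpha> \<in> exponents_on n m I" for \<alpha>
    proof -
      have "{j\<in>{1..m}. \<alpha> j \<noteq> 0} \<subseteq> I"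
        using that by (auto simp: exponents_on_def simp del: One_nat_def) (metis DiffI atLeastAtMost_iff less_not_refl)
      then show ?thesis
        using card_mono[OF finite_subset[OF I(1)]] I(2) by (auto simp: exponent_order_def)
    qed
    then show "factorially_projects n I F"
      using factorially_projects_iff_coefficients[OF assms(1,2) I(1) pos] van
        exponents_on_subset[of n m I] by blast
  qed
qed

theorem proposition4:
  fixes m :: nat and n :: "nat \<Rightarrow> nat"
    and F :: "(nat \<Rightarrow> complex) multiset"
    and b :: "(nat \<Rightarrow> nat) \<Rightarrow> complex"
    and I :: "nat set"
  assumes "m \<ge> 1"
    and "\<And>j. j \<in> {1..m} \<Longrightarrow> n j \<ge> 1"
    and "is_fraction n m F"
    and "counting_coefficients n m F b"
    and "I \<subseteq> {1..m}" and "I \<noteq> {}"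
  shows
    "(\<forall>\<zeta>\<in>full_design n I.
        of_nat (replicates I F \<zeta>) =
          of_nat (card (full_design n ({1..m} - I))) *
          (\<Sum>\<alpha>\<in>exponents_on n m I. b \<alpha> * monomial I \<alpha> \<zeta>))
     \<and>
     ((factorially_projects n I F \<longleftrightarrow>
        (\<forall>\<zeta>\<in>full_design n I.
           of_nat (replicates I F \<zeta>) =
             of_nat (card (full_design n ({1..m} - I))) * b (zero_exponent m) \<and>
           of_nat (card (full_design n ({1..m} - I))) * b (zero_exponent m) =
             of_nat (size F) / of_nat (card (full_design n I))))
      \<and> (factorially_projects n I F \<longleftrightarrow>
        (\<forall>\<alpha>\<in>exponents_on n m I. \<alpha> \<noteq> zero_exponent m \<longrightarrow> b \<alpha> = 0))
      \<and> (factorially_projects n I F \<longrightarrow> (\<forall>i\<in>I. levels_equally_often n i F)))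
     \<and>
     (\<forall>J. J \<noteq> {} \<and> J \<subset> {1..m} \<and>
        (\<forall>\<alpha>\<in>exponents n m. \<alpha> \<noteq> zero_exponent m \<and> b \<alpha> \<noteq> 0 \<longrightarrow> (\<forall>j\<in>J. \<alpha> j \<noteq> 0))
        \<longrightarrow> factorially_projects n ({1..m} - J) F)
     \<and>
     (\<forall>t. 1 \<le> t \<and> t \<le> m \<longrightarrow>
        (orthogonal_array n m t F \<longleftrightarrow>
          (\<forall>\<alpha>\<in>exponents n m.
             exponent_order m \<alpha> \<le> t \<and> \<alpha> \<noteq> zero_exponent m \<longrightarrow> b \<alpha> = 0)))"
proof (intro conjI)
  note pos = assms(2) and frac = assms(3,4) and I = assms(5,6)
  note crit = factorially_projects_iff_coefficients[OF frac _ pos]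
  show "\<forall>\<zeta>\<in>full_design n I. of_nat (replicates I F \<zeta>) =
      of_nat (card (full_design n ({1..m} - I))) *
      (\<Sum>\<alpha>\<in>exponents_on n m I. b \<alpha> * monomial I \<alpha> \<zeta>)"
    using replicates_expansion[OF frac I(1) pos] by blast
  show "factorially_projects n I F \<longleftrightarrow>
      (\<forall>\<zeta>\<in>full_design n I.
         of_nat (replicates I F \<zeta>) =
           of_nat (card (full_design n ({1..m} - I))) * b (zero_exponent m) \<and>
         of_nat (card (full_design n ({1..m} - I))) * b (zero_exponent m) =
           of_nat (size F) / of_nat (card (full_design n I)))"
    by (rule factorially_projects_iff_replicates[OF frac I(1) pos])
  show "factorially_projects n I F \<longleftrightarrow>
      (\<forall>\<alpha>\<in>exponents_on n m I. \<alpha> \<noteq> zero_exponent m \<longrightarrow> b \<alpha> = 0)"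
    by (rule crit[OF I(1)])
  show "factorially_projects n I F \<longrightarrow> (\<forall>i\<in>I. levels_equally_often n i F)"
  proof (intro impI ballI)
    fix i assume proj: "factorially_projects n I F" and i: "i \<in> I"
    have "factorially_projects n {i} F"
      using proj crit[OF I(1)] crit[of "{i}"] exponents_on_mono[of "{i}" I n m] i I(1) by blast
    then show "levels_equally_often n i F"
      by (rule levels_equally_often_if_factorially_projects)
  qed
  show "\<forall>J. J \<noteq> {} \<and> J \<subset> {1..m} \<and>
      (\<forall>\<alpha>\<in>exponents n m. \<alpha> \<noteq> zero_exponent m \<and> b \<alpha> \<noteq> 0 \<longrightarrow> (\<forall>j\<in>J. \<alpha> j \<noteq> 0))
      \<longrightarrow> factorially_projects n ({1..m} - J) F"
  proof (intro allI impI, elim conjE)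
    fix J
    assume J: "J \<noteq> {}" "J \<subset> {1..m}"
      and all: "\<forall>\<alpha>\<in>exponents n m. \<alpha> \<noteq> zero_exponent m \<and> b \<alpha> \<noteq> 0 \<longrightarrow> (\<forall>j\<in>J. \<alpha> j \<noteq> 0)"
    have "b \<alpha> = 0" if "\<alpha> \<in> exponents_on n m ({1..m} - J)" "\<alpha> \<noteq> zero_exponent m" for \<alpha>
      using that all J by (fastforce simp: exponents_on_def)
    then show "factorially_projects n ({1..m} - J) F"
      using crit[of "{1..m} - J"] by blast
  qed
  show "\<forall>t. 1 \<le> t \<and> t \<le> m \<longrightarrow>
      (orthogonal_array n m t F \<longleftrightarrow>
        (\<forall>\<alpha>\<in>exponents n m.
           exponent_order m \<alpha> \<le> t \<and> \<alpha> \<noteq> zero_exponent m \<longrightarrow> b \<alpha> = 0))"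
    using orthogonal_array_iff_coefficients[OF frac pos] by blast
qed

end
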